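(* Let $\sigma>0$. For every clipping threshold $0<c\le 2\sigma$ there exists a stochastic function $f(\mathbf{x})=\mathbb{E}_{\xi\sim\mathcal{D}}[f_\xi(\mathbf{x})]$ on some $\mathbb{R}^d$ that has variance at most $\sigma^2$, i.e. $\mathbb{E}_\xi\big[\|\nabla f_\xi(\mathbf{x})-\nabla f(\mathbf{x})\|^2\big]\le\sigma^2$ for all $\mathbf{x}$, and is $(L_0,L_1)$-smooth with $L_0=1$, $L_1=0$, such that: fixed points of clipped SGD exist, i.e. there is at least one point $\mathbf{x}^\star$ with $\mathbb{E}_\xi[\mathrm{clip}_c(\nabla f_\xi(\mathbf{x}^\star))]=0$; and every such fixed point $\mathbf{x}^\star$ satisfies $\|\nabla f(\mathbf{x}^\star)\|\ge \sigma/12$.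
   Context: $\|\cdot\|$ is the Euclidean norm. Each $f_\xi$ is differentiable and $\mathbb{E}_\xi[\nabla f_\xi(\mathbf{x})]=\nabla f(\mathbf{x})$. $(L_0,L_1)$-smoothness: $f$ is differentiable and $\|\nabla f(\mathbf{x})-\nabla f(\mathbf{y})\|\le (L_0+L_1\|\nabla f(\mathbf{x})\|)\,\|\mathbf{x}-\mathbf{y}\|$ for all $\mathbf{x},\mathbf{y}$ with $\|\mathbf{x}-\mathbf{y}\|\le 1/L_1$. For $L_0=1,L_1=0$ (with $1/L_1=+\infty$) this says that $\nabla f$ is $1$-Lipschitz. Clipping operator: $\mathrm{clip}_c(\mathbf{u})=\min\big(1,\frac{c}{\|\mathbf{u}\|}\big)\mathbf{u}$ (with $\mathrm{clip}_c(0)=0$). *)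

theory Defs
  imports "HOL-Probability.Probability"
begin

text \<open>
  The dimension \<open>d\<close> is existentially quantified in the theorem, so it cannot be a type:
  \<open>\<real>\<^sup>d\<close> is the space of real sequences that vanish from index \<open>d\<close> on.
  Subtraction of vectors is the pointwise subtraction of functions, and the Euclidean norm of a
  vector \<open>u\<close> is the library's \<open>L2_set u {..<d}\<close>.
\<close>

definition Rn :: "nat \<Rightarrow> (nat \<Rightarrow> real) set" where
  "Rn d = {x. \<forall>i\<ge>d. x i = 0}"

definition enorm :: "nat \<Rightarrow> (nat \<Rightarrow> real) \<Rightarrow> real" where
  "enorm d u = L2_set u {..<d}"

text \<open>Frechet differentiability on \<open>\<real>\<^sup>d\<close>, with the derivative represented by the gradient.\<close>

definition has_gradient :: "nat \<Rightarrow> ((nat \<Rightarrow> real) \<Rightarrow> real) \<Rightarrow> (nat \<Rightarrow> real) \<Rightarrow> (nat \<Rightarrow> real) \<Rightarrow> bool" where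
  "has_gradient d F x g \<longleftrightarrow> g \<in> Rn d \<and>
     (\<forall>e>0. \<exists>r>0. \<forall>y\<in>Rn d. enorm d (y - x) < r \<longrightarrow>
        \<bar>F y - F x - (\<Sum>i<d. g i * (y i - x i))\<bar> \<le> e * enorm d (y - x))"

definition differentiable_Rn :: "nat \<Rightarrow> ((nat \<Rightarrow> real) \<Rightarrow> real) \<Rightarrow> bool" where
  "differentiable_Rn d F \<longleftrightarrow> (\<forall>x\<in>Rn d. \<exists>g. has_gradient d F x g)"

definition grad :: "nat \<Rightarrow> ((nat \<Rightarrow> real) \<Rightarrow> real) \<Rightarrow> (nat \<Rightarrow> real) \<Rightarrow> (nat \<Rightarrow> real)" where
  "grad d F x = (THE g. has_gradient d F x g)"

lemma has_gradient_unique: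
  assumes x: "x \<in> Rn d" and g: "has_gradient d F x g" and h: "has_gradient d F x h"
  shows "g = h"
proof (rule ccontr)
  assume "g \<noteq> h"
  define u where "u = g - h"
  define N where "N = enorm d u"
  have gR: "g \<in> Rn d" and hR: "h \<in> Rn d" using g h by (auto simp: has_gradient_def)
  have "N \<noteq> 0"
  proof
    assume "N = 0"
    then have "\<forall>i<d. g i = h i"
      by (auto simp: N_def enorm_def u_def L2_set_eq_0_iff)
    moreover have "\<forall>i\<ge>d. g i = h i" using gR hR by (auto simp: Rn_def)
    ultimately have "g i = h i" for i by (cases "i < d") auto
    then show False using \<open>g \<noteq> h\<close> by auto
  qed
  then have N: "N > 0" by (simp add: N_def enorm_def less_le L2_set_nonneg)
  then have N4: "N / 4 > 0" by simp
  obtain r where r: "r > 0" and rg: "\<And>y. \<lbrakk>y \<in> Rn d; enorm d (y - x) < r\<rbrakk> \<Longrightarrow>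
      \<bar>F y - F x - (\<Sum>i<d. g i * (y i - x i))\<bar> \<le> N / 4 * enorm d (y - x)"
    using g N4 unfolding has_gradient_def by blast
  obtain s where s: "s > 0" and sh: "\<And>y. \<lbrakk>y \<in> Rn d; enorm d (y - x) < s\<rbrakk> \<Longrightarrow>
      \<bar>F y - F x - (\<Sum>i<d. h i * (y i - x i))\<bar> \<le> N / 4 * enorm d (y - x)"
    using h N4 unfolding has_gradient_def by blast
  define t where "t = min r s / (2 * N)"
  have t: "t > 0" using r s N by (simp add: t_def)
  define y where "y = (\<lambda>i. x i + t * u i)"
  have yR: "y \<in> Rn d" using x gR hR by (simp add: y_def u_def Rn_def)
  have yx: "y - x = (\<lambda>i. t * u i)" by (simp add: y_def fun_eq_iff)
  have nyx: "enorm d (y - x) = t * N"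
    unfolding yx enorm_def N_def using t L2_set_right_distrib[of t u "{..<d}"] by simp
  have small: "t * N < r" "t * N < s" using r s N by (auto simp: t_def min_def)
  have "(\<Sum>i<d. g i * (y i - x i)) - (\<Sum>i<d. h i * (y i - x i)) = t * (\<Sum>i<d. (u i)\<^sup>2)"
    by (simp add: sum_subtractf[symmetric] sum_distrib_left y_def u_def power2_eq_square algebra_simps)
  also have "(\<Sum>i<d. (u i)\<^sup>2) = N\<^sup>2"
    by (simp add: N_def enorm_def L2_set_def sum_nonneg)
  finally have diff: "(\<Sum>i<d. g i * (y i - x i)) - (\<Sum>i<d. h i * (y i - x i)) = t * N\<^sup>2" .
  have "\<bar>F y - F x - (\<Sum>i<d. g i * (y i - x i))\<bar> \<le> N / 4 * (t * N)"
    using rg[OF yR] small unfolding nyx by blast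
  moreover have "\<bar>F y - F x - (\<Sum>i<d. h i * (y i - x i))\<bar> \<le> N / 4 * (t * N)"
    using sh[OF yR] small unfolding nyx by blast
  ultimately have "t * N\<^sup>2 \<le> N / 4 * (t * N) + N / 4 * (t * N)"
    using diff by linarith
  then have "t * N\<^sup>2 \<le> t * N\<^sup>2 / 2" by (simp add: power2_eq_square algebra_simps)
  then show False using t N by (simp add: zero_less_power)
qed

lemma grad_eq: "x \<in> Rn d \<Longrightarrow> has_gradient d F x g \<Longrightarrow> grad d F x = g"
  unfolding grad_def by (blast intro: has_gradient_unique)

text \<open>For \<open>L1 = 0\<close> the radius \<open>1 / L1\<close> is read as infinity (not as the HOL value \<open>0\<close>).\<close>

definition L0_L1_smooth :: "nat \<Rightarrow> real \<Rightarrow> real \<Rightarrow> ((nat \<Rightarrow> real) \<Rightarrow> real) \<Rightarrow> bool" where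
  "L0_L1_smooth d L0 L1 f \<longleftrightarrow> differentiable_Rn d f \<and>
     (\<forall>x\<in>Rn d. \<forall>y\<in>Rn d. L1 = 0 \<or> enorm d (x - y) \<le> 1 / L1 \<longrightarrow>
        enorm d (grad d f x - grad d f y) \<le> (L0 + L1 * enorm d (grad d f x)) * enorm d (x - y))"

text \<open>At \<open>u = 0\<close> the value is \<open>0\<close>, as required.\<close>

definition clip :: "nat \<Rightarrow> real \<Rightarrow> (nat \<Rightarrow> real) \<Rightarrow> (nat \<Rightarrow> real)" where
  "clip d c u = (\<lambda>i. min 1 (c / enorm d u) * u i)"

definition vexp :: "'s measure \<Rightarrow> ('s \<Rightarrow> nat \<Rightarrow> real) \<Rightarrow> (nat \<Rightarrow> real)" where
  "vexp D V = (\<lambda>i. \<integral>\<xi>. V \<xi> i \<partial>D)"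

definition stochastic_function ::
  "nat \<Rightarrow> 's measure \<Rightarrow> ('s \<Rightarrow> (nat \<Rightarrow> real) \<Rightarrow> real) \<Rightarrow> ((nat \<Rightarrow> real) \<Rightarrow> real) \<Rightarrow> bool" where
  "stochastic_function d D F f \<longleftrightarrow> prob_space D \<and>
     (\<forall>\<xi>\<in>space D. differentiable_Rn d (F \<xi>)) \<and> differentiable_Rn d f \<and>
     (\<forall>x\<in>Rn d. integrable D (\<lambda>\<xi>. F \<xi> x) \<and> f x = (\<integral>\<xi>. F \<xi> x \<partial>D)) \<and>
     (\<forall>x\<in>Rn d. (\<forall>i. integrable D (\<lambda>\<xi>. grad d (F \<xi>) x i)) \<and>
                vexp D (\<lambda>\<xi>. grad d (F \<xi>) x) = grad d f x)"

definition variance_at_most ::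
  "nat \<Rightarrow> 's measure \<Rightarrow> ('s \<Rightarrow> (nat \<Rightarrow> real) \<Rightarrow> real) \<Rightarrow> ((nat \<Rightarrow> real) \<Rightarrow> real) \<Rightarrow> real \<Rightarrow> bool" where
  "variance_at_most d D F f v \<longleftrightarrow>
     (\<forall>x\<in>Rn d. integrable D (\<lambda>\<xi>. (enorm d (grad d (F \<xi>) x - grad d f x))\<^sup>2) \<and>
                (\<integral>\<xi>. (enorm d (grad d (F \<xi>) x - grad d f x))\<^sup>2 \<partial>D) \<le> v)"

text \<open>
  The integrand below is bounded and, for a stochastic function, measurable in each coordinate,
  so no separate integrability condition is needed.
\<close>

definition clipped_fixed_point ::
  "nat \<Rightarrow> real \<Rightarrow> 's measure \<Rightarrow> ('s \<Rightarrow> (nat \<Rightarrow> real) \<Rightarrow> real) \<Rightarrow> (nat \<Rightarrow> real) \<Rightarrow> bool" where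
  "clipped_fixed_point d c D F x \<longleftrightarrow>
     x \<in> Rn d \<and> vexp D (\<lambda>\<xi>. clip d c (grad d (F \<xi>) x)) = (\<lambda>i. 0)"

end

theory Submission
  imports Defs
begin

text \<open>
  In dimension one take \<open>f x = x\<^sup>2 / 2\<close> with gradient noise \<open>\<xi>\<close> equal to \<open>4 \<sigma>\<close> with probability
  \<open>1/17\<close> and to \<open>- \<sigma> / 4\<close> otherwise, which has mean \<open>0\<close> and variance \<open>\<sigma>\<^sup>2\<close>. Clipping cuts off
  the rare large value, so that the clipped gradients balance at \<open>x = \<sigma> / 4 - c / 16 \<ge> \<sigma> / 8\<close>,
  where only the large value is clipped. If \<open>x < \<sigma> / 12\<close>, then the large value contributes at most
  \<open>c / 17\<close>, while the frequent value contributes at most \<open>- 16 / 17 * min c (\<sigma> / 6)\<close>, and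
  \<open>c \<le> 2 * \<sigma>\<close> makes the sum negative.
\<close>

text \<open>The linear term shifts the gradient by \<open>t\<close>, so random \<open>t\<close> acts
  as additive gradient noise.\<close>

definition tilted_square :: "real \<Rightarrow> (nat \<Rightarrow> real) \<Rightarrow> real" where
  "tilted_square t x = (x 0)\<^sup>2 / 2 + t * x 0"

definition skewed_noise :: "real \<Rightarrow> real pmf" where
  "skewed_noise \<sigma> = map_pmf (\<lambda>b. if b then 4 * \<sigma> else - \<sigma> / 4) (bernoulli_pmf (1 / 17))"

lemma enorm_1: "enorm 1 u = \<bar>u 0\<bar>"
  by (simp add: enorm_def lessThan_Suc)

lemma has_gradient_tilted_square:
  "has_gradient 1 (tilted_square t) x (\<lambda>i. if i = 0 then x 0 + t else 0)"
  unfolding has_gradient_def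
proof (intro conjI allI impI)
  show "(\<lambda>i. if i = 0 then x 0 + t else 0) \<in> Rn 1" by (simp add: Rn_def)
next
  fix e :: real assume "e > 0"
  show "\<exists>r>0. \<forall>y\<in>Rn 1. enorm 1 (y - x) < r \<longrightarrow>
     \<bar>tilted_square t y - tilted_square t x - (\<Sum>i<1. (if i = 0 then x 0 + t else 0) * (y i - x i))\<bar>
       \<le> e * enorm 1 (y - x)"
  \<comment> \<open>The Taylor remainder of this quadratic is exactly half the squared
    distance.\<close>
  proof (intro exI[of _ "2 * e"] conjI ballI impI)
    show "0 < 2 * e" using \<open>e > 0\<close> by simp
  next
    fix y assume "enorm 1 (y - x) < 2 * e"
    then have h: "\<bar>y 0 - x 0\<bar> / 2 \<le> e" by (simp add: enorm_1[simplified])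
    have eq: "tilted_square t y - tilted_square t x - (\<Sum>i<1. (if i = 0 then x 0 + t else 0) * (y i - x i))
        = (\<bar>y 0 - x 0\<bar> / 2) * \<bar>y 0 - x 0\<bar>"
      by (simp add: tilted_square_def field_simps power2_eq_square)
    show "\<bar>tilted_square t y - tilted_square t x - (\<Sum>i<1. (if i = 0 then x 0 + t else 0) * (y i - x i))\<bar>
        \<le> e * enorm 1 (y - x)"
      unfolding eq enorm_1 using mult_right_mono[OF h, of "\<bar>y 0 - x 0\<bar>"] by (simp add: abs_mult)
  qed
qed

lemma differentiable_tilted_square: "differentiable_Rn 1 (tilted_square t)"
  unfolding differentiable_Rn_def using has_gradient_tilted_square by blast

lemma grad_tilted_square:
  "x \<in> Rn 1 \<Longrightarrow> grad 1 (tilted_square t) x = (\<lambda>i. if i = 0 then x 0 + t else 0)"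
  by (rule grad_eq[OF _ has_gradient_tilted_square])

lemma L0_L1_smooth_tilted_square: "L0_L1_smooth 1 1 0 (tilted_square t)"
  by (simp add: L0_L1_smooth_def differentiable_tilted_square[simplified]
      grad_tilted_square[simplified] enorm_1[simplified])

lemma integrable_skewed_noise:
  fixes g :: "real \<Rightarrow> real"
  shows "integrable (measure_pmf (skewed_noise \<sigma>)) g"
  by (rule integrable_measure_pmf_finite) (simp add: skewed_noise_def)

lemma integral_skewed_noise:
  fixes g :: "real \<Rightarrow> real"
  shows "(\<integral>\<xi>. g \<xi> \<partial>measure_pmf (skewed_noise \<sigma>)) = g (4 * \<sigma>) / 17 + 16 * g (- \<sigma> / 4) / 17"
  by (simp add: skewed_noise_def integral_map_pmf)

lemma stochastic_function_skewed_noise: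
  "stochastic_function 1 (measure_pmf (skewed_noise \<sigma>)) tilted_square (tilted_square 0)"
  unfolding stochastic_function_def
proof (intro conjI ballI allI)
  show "prob_space (measure_pmf (skewed_noise \<sigma>))" by (rule prob_space_measure_pmf)
  fix x assume x: "x \<in> Rn 1"
  show "tilted_square 0 x = (\<integral>\<xi>. tilted_square \<xi> x \<partial>measure_pmf (skewed_noise \<sigma>))"
    unfolding integral_skewed_noise by (simp add: tilted_square_def field_simps)
  show "vexp (measure_pmf (skewed_noise \<sigma>)) (\<lambda>\<xi>. grad 1 (tilted_square \<xi>) x) =
      grad 1 (tilted_square 0) x"
    unfolding vexp_def integral_skewed_noise grad_tilted_square[OF x]
    by (auto simp: fun_eq_iff field_simps)
qed (rule differentiable_tilted_square integrable_skewed_noise)+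

text \<open>The gradient deviates by the noise itself at every point, so the bound is attained:
  \<open>(16 * \<sigma>\<^sup>2 + \<sigma>\<^sup>2) / 17 = \<sigma>\<^sup>2\<close>.\<close>

lemma variance_at_most_skewed_noise:
  "variance_at_most 1 (measure_pmf (skewed_noise \<sigma>)) tilted_square (tilted_square 0) (\<sigma>\<^sup>2)"
  unfolding variance_at_most_def integral_skewed_noise
  by (simp add: integrable_skewed_noise grad_tilted_square[simplified] enorm_1[simplified]
      power2_eq_square)

definition clip_real :: "real \<Rightarrow> real \<Rightarrow> real" where
  "clip_real c u = min 1 (c / \<bar>u\<bar>) * u"

text \<open>This piecewise linear form reduces the fixed point equation to linear arithmetic by
  cases.\<close>

lemma clip_real_eq: "c > 0 \<Longrightarrow> clip_real c u = max (- c) (min c u)"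
  by (cases "u = 0") (auto simp: clip_real_def min_def max_def field_simps abs_if split: if_splits)

lemma clipped_fixed_point_skewed_noise_iff:
  "clipped_fixed_point 1 c (measure_pmf (skewed_noise \<sigma>)) tilted_square x \<longleftrightarrow>
     x \<in> Rn 1 \<and> clip_real c (x 0 + 4 * \<sigma>) + 16 * clip_real c (x 0 - \<sigma> / 4) = 0"
proof (cases "x \<in> Rn 1")
  case True
  have "vexp (measure_pmf (skewed_noise \<sigma>)) (\<lambda>\<xi>. clip 1 c (grad 1 (tilted_square \<xi>) x)) =
      (\<lambda>i. if i = 0 then (clip_real c (x 0 + 4 * \<sigma>) + 16 * clip_real c (x 0 - \<sigma> / 4)) / 17 else 0)"
    unfolding vexp_def integral_skewed_noise grad_tilted_square[OF True] clip_def enorm_1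
    by (auto simp: fun_eq_iff clip_real_def add_divide_distrib)
  with True show ?thesis
    by (auto simp: clipped_fixed_point_def fun_eq_iff)
qed (simp add: clipped_fixed_point_def)

theorem theorem3p1:
  fixes \<sigma> c :: real
  assumes "\<sigma> > 0" and "0 < c" and "c \<le> 2 * \<sigma>"
  shows "\<exists>(d :: nat) (D :: real measure) (F :: real \<Rightarrow> (nat \<Rightarrow> real) \<Rightarrow> real) (f :: (nat \<Rightarrow> real) \<Rightarrow> real).
           d \<ge> 1 \<and>
           stochastic_function d D F f \<and>
           variance_at_most d D F f (\<sigma>\<^sup>2) \<and>
           L0_L1_smooth d 1 0 f \<and>
           (\<exists>x. clipped_fixed_point d c D F x) \<and>
           (\<forall>x. clipped_fixed_point d c D F x \<longrightarrow> enorm d (grad d f x) \<ge> \<sigma> / 12)"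
proof (intro exI conjI allI impI)
  show "(1 :: nat) \<le> 1" by simp
  show "stochastic_function 1 (measure_pmf (skewed_noise \<sigma>)) tilted_square (tilted_square 0)"
    by (rule stochastic_function_skewed_noise)
  show "variance_at_most 1 (measure_pmf (skewed_noise \<sigma>)) tilted_square (tilted_square 0) (\<sigma>\<^sup>2)"
    by (rule variance_at_most_skewed_noise)
  show "L0_L1_smooth 1 1 0 (tilted_square 0)"
    by (rule L0_L1_smooth_tilted_square)
  show "clipped_fixed_point 1 c (measure_pmf (skewed_noise \<sigma>)) tilted_square
      (\<lambda>i. if i = 0 then \<sigma> / 4 - c / 16 else 0)"
    \<comment> \<open>The frequent gradient is \<open>- c / 16\<close>, which clipping leaves alone.
      The rare one is \<open>17 * \<sigma> / 4 - c / 16\<close>, at least \<open>c\<close> because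
      \<open>c \<le> 4 * \<sigma>\<close>, so it is clipped to \<open>c\<close>.\<close>
    unfolding clipped_fixed_point_skewed_noise_iff clip_real_eq[OF \<open>0 < c\<close>]
    using assms by (auto simp: Rn_def min_def max_def)
next
  fix x
  assume "clipped_fixed_point 1 c (measure_pmf (skewed_noise \<sigma>)) tilted_square x"
  then have x: "x \<in> Rn 1"
    and fp: "max (- c) (min c (x 0 + 4 * \<sigma>)) + 16 * max (- c) (min c (x 0 - \<sigma> / 4)) = 0"
    unfolding clipped_fixed_point_skewed_noise_iff clip_real_eq[OF \<open>0 < c\<close>] by auto
  \<comment> \<open>Otherwise \<open>x 0 - \<sigma> / 4 < - \<sigma> / 6\<close>, and since
    \<open>16 * \<sigma> / 6 > 2 * \<sigma> \<ge> c\<close>, the second summand lies below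
    \<open>- c\<close>, while the first is at most \<open>c\<close>.\<close>
  have "x 0 \<ge> \<sigma> / 12"
    using fp assms by (auto simp: min_def max_def split: if_splits)
  then show "\<sigma> / 12 \<le> enorm 1 (grad 1 (tilted_square 0) x)"
    unfolding grad_tilted_square[OF x] enorm_1 by simp
qed

end
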